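(* Let $G$ be an infinite finitely generated polycyclic group. Then every translation-invariant pointwise closed linear subspace $X$ of $\mathrm{Lip}_0(G)$ is finitely presented, i.e. there exist finitely many $x_1,\dots,x_n\in\mathbb{R}[G]$ such that $\tilde X=\big(\mathrm{Lip}_0(G)\oplus\mathrm{constants}\big)\cap\bigcap_{i=1}^n\ker(P_{x_i})$.
   Context: Fix a finite symmetric generating set $S$ of $G$; $G$ is viewed as its Cayley graph with edges $(g,gs)$, $g\in G$, $s\in S$, with the associated graph (word) metric and distinguished vertex $1_G$. A finitely generated group $G$ is polycyclic if there is a series $1=G_0\trianglelefteq G_1\trianglelefteq\dots\trianglelefteq G_m=G$ with each $G_i/G_{i-1}$ cyclic. $\mathrm{Lip}_0(G)$ is the Banach space of Lipschitz functions $f:G\to\mathbb{R}$ with $f(1_G)=0$, normed by the optimal Lipschitz constant. For $g\in G$, $f\in\mathrm{Lip}_0(G)$, $(g\cdot f)(x)=f(g^{-1}x)-f(g^{-1})$; a linear subspace $X$ is (translation-)invariant if $g\cdot X=X$ for all $g\in G$. It is pointwise closed if it is closed in $\mathrm{Lip}_0(G)$ for pointwise convergence. $\mathrm{constants}$ is the space of constant real functions on $G$; $\mathrm{Lip}_0(G)\oplus\mathrm{constants}$ is regarded as the space of all real Lipschitz functions on $G$, and $\tilde X:=X\oplus\mathrm{constants}$. $\mathbb{R}[G]$ is the real group algebra, viewed as the finitely supported functions in $\mathbb{R}^G$. For $x\in\mathbb{R}[G]$ and $f\in\mathbb{R}^G$, $(f\star x)(g)=\sum_{h\in G}f(gh^{-1})x(h)$,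 $P_x(f)=f\star x$, and $\ker(P_x)=\{f\in\mathbb{R}^G: P_x(f)=0\}$. *)

theory Defs
  imports "HOL-Analysis.Analysis" "HOL-Algebra.Elementary_Groups"
begin

text \<open>
  Groups are HOL-Algebra groups. Real functions on a group \<open>G\<close> are represented by the
  extensional functions on \<open>carrier G\<close> (the points of \<^term>\<open>powertop_real (carrier G)\<close>), so
  that equality of functions is equality on \<open>carrier G\<close>.
\<close>

definition polycyclic :: "('a, 'b) monoid_scheme \<Rightarrow> bool" where
  "polycyclic G \<longleftrightarrow>
     (\<exists>(m::nat) H.
        H 0 = {\<one>\<^bsub>G\<^esub>} \<and> H m = carrier G \<and>
        (\<forall>i\<le>m. subgroup (H i) G) \<and>
        (\<forall>i<m. H i \<lhd> (G\<lparr>carrier := H (Suc i)\<rparr>) \<and>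
               cyclic_group (G\<lparr>carrier := H (Suc i)\<rparr> Mod H i)))"

definition finite_symmetric_generating_set :: "('a, 'b) monoid_scheme \<Rightarrow> 'a set \<Rightarrow> bool" where
  "finite_symmetric_generating_set G S \<longleftrightarrow>
     finite S \<and> S \<subseteq> carrier G \<and> m_inv G ` S = S \<and> generate G S = carrier G"


definition cayley_edges :: "('a, 'b) monoid_scheme \<Rightarrow> 'a set \<Rightarrow> ('a \<times> 'a) set" where
  "cayley_edges G S = {(g, g \<otimes>\<^bsub>G\<^esub> s) | g s. g \<in> carrier G \<and> s \<in> S}"

definition cayley_dist :: "('a, 'b) monoid_scheme \<Rightarrow> 'a set \<Rightarrow> 'a \<Rightarrow> 'a \<Rightarrow> real" where
  "cayley_dist G S g h = real (LEAST n. (g, h) \<in> cayley_edges G S ^^ n)"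

text \<open>The graph metric; see \<open>Metric_space_cayley\<close> below for the proof that it is a metric.\<close>
definition cayley_metric :: "('a, 'b) monoid_scheme \<Rightarrow> 'a set \<Rightarrow> 'a metric" where
  "cayley_metric G S = metric (carrier G, cayley_dist G S)"

definition real_functions :: "('a, 'b) monoid_scheme \<Rightarrow> ('a \<Rightarrow> real) set" where
  "real_functions G = (\<Pi>\<^sub>E g\<in>carrier G. UNIV)"

definition Lip0 :: "('a, 'b) monoid_scheme \<Rightarrow> 'a set \<Rightarrow> ('a \<Rightarrow> real) set" where
  "Lip0 G S =
     {f \<in> real_functions G.
        Lipschitz_continuous_map (cayley_metric G S) euclidean_metric f \<and> f \<one>\<^bsub>G\<^esub> = 0}"

definition translate :: "('a, 'b) monoid_scheme \<Rightarrow> 'a \<Rightarrow> ('a \<Rightarrow> real) \<Rightarrow> 'a \<Rightarrow> real" where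
  "translate G g f = (\<lambda>x\<in>carrier G. f (inv\<^bsub>G\<^esub> g \<otimes>\<^bsub>G\<^esub> x) - f (inv\<^bsub>G\<^esub> g))"

definition translation_invariant :: "('a, 'b) monoid_scheme \<Rightarrow> ('a \<Rightarrow> real) set \<Rightarrow> bool" where
  "translation_invariant G X \<longleftrightarrow> (\<forall>g\<in>carrier G. translate G g ` X = X)"

definition linear_subspace_of ::
    "('a, 'b) monoid_scheme \<Rightarrow> ('a \<Rightarrow> real) set \<Rightarrow> ('a \<Rightarrow> real) set \<Rightarrow> bool" where
  "linear_subspace_of G V X \<longleftrightarrow>
     X \<subseteq> V \<and>
     (\<lambda>x\<in>carrier G. 0) \<in> X \<and>
     (\<forall>f\<in>X. \<forall>h\<in>X. (\<lambda>x\<in>carrier G. f x + h x) \<in> X) \<and>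
     (\<forall>c. \<forall>f\<in>X. (\<lambda>x\<in>carrier G. c * f x) \<in> X)"

definition pointwise_closed_in ::
    "('a, 'b) monoid_scheme \<Rightarrow> ('a \<Rightarrow> real) set \<Rightarrow> ('a \<Rightarrow> real) set \<Rightarrow> bool" where
  "pointwise_closed_in G V X \<longleftrightarrow> closedin (subtopology (powertop_real (carrier G)) V) X"

definition constants :: "('a, 'b) monoid_scheme \<Rightarrow> ('a \<Rightarrow> real) set" where
  "constants G = {\<lambda>x\<in>carrier G. c | c. True}"

text \<open>
  \<open>X \<oplus> constants\<close>, realised inside the functions on \<open>G\<close>. For \<open>X \<subseteq> Lip0 G S\<close> the sum is
  direct because members of \<open>X\<close> vanish at the unit.
\<close>
definition plus_constants :: "('a, 'b) monoid_scheme \<Rightarrow> ('a \<Rightarrow> real) set \<Rightarrow> ('a \<Rightarrow> real) set" where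
  "plus_constants G X = {\<lambda>x\<in>carrier G. f x + c x | f c. f \<in> X \<and> c \<in> constants G}"

definition real_group_algebra :: "('a, 'b) monoid_scheme \<Rightarrow> ('a \<Rightarrow> real) set" where
  "real_group_algebra G = {x \<in> real_functions G. finite {h \<in> carrier G. x h \<noteq> 0}}"

text \<open>The sum is over the support of \<open>x\<close>, since sums over infinite sets are \<open>0\<close> by convention.\<close>
definition convolution ::
    "('a, 'b) monoid_scheme \<Rightarrow> ('a \<Rightarrow> real) \<Rightarrow> ('a \<Rightarrow> real) \<Rightarrow> 'a \<Rightarrow> real" where
  "convolution G f x =
     (\<lambda>g\<in>carrier G. \<Sum>h | h \<in> carrier G \<and> x h \<noteq> 0. f (g \<otimes>\<^bsub>G\<^esub> inv\<^bsub>G\<^esub> h) * x h)"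

definition ker_P :: "('a, 'b) monoid_scheme \<Rightarrow> ('a \<Rightarrow> real) \<Rightarrow> ('a \<Rightarrow> real) set" where
  "ker_P G x = {f \<in> real_functions G. convolution G f x = (\<lambda>g\<in>carrier G. 0)}"

definition finitely_presented ::
    "('a, 'b) monoid_scheme \<Rightarrow> 'a set \<Rightarrow> ('a \<Rightarrow> real) set \<Rightarrow> bool" where
  "finitely_presented G S X \<longleftrightarrow>
     (\<exists>(n::nat) x. (\<forall>i\<in>{1..n}. x i \<in> real_group_algebra G) \<and>
        plus_constants G X = plus_constants G (Lip0 G S) \<inter> (\<Inter>i\<in>{1..n}. ker_P G (x i)))"


context
  fixes G :: "('a, 'b) monoid_scheme" (structure) and S :: "'a set"
  assumes grp: "group G" and gen: "finite_symmetric_generating_set G S"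
begin

interpretation group G by (rule grp)

lemma cayley_edges_carrier: "(g, h) \<in> cayley_edges G S \<Longrightarrow> g \<in> carrier G \<and> h \<in> carrier G"
  using gen by (auto simp: cayley_edges_def finite_symmetric_generating_set_def)

lemma cayley_edges_sym: "sym (cayley_edges G S)"
proof (rule symI)
  fix a b assume "(a, b) \<in> cayley_edges G S"
  then obtain s where s: "a \<in> carrier G" "s \<in> S" "b = a \<otimes> s"
    by (auto simp: cayley_edges_def)
  have sc: "s \<in> carrier G" "inv s \<in> S"
    using gen s by (auto simp: finite_symmetric_generating_set_def)
  have "a = b \<otimes> inv s" using s sc by (simp add: m_assoc)
  moreover have "b \<in> carrier G" using s sc by simp
  ultimately show "(b, a) \<in> cayley_edges G S"
    using sc(2) unfolding cayley_edges_def mem_Collect_eq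
    by (intro exI[of _ b] exI[of _ "inv s"] conjI) simp_all
qed

lemma cayley_path_translate:
  assumes "h \<in> generate G S" "g \<in> carrier G"
  shows "(g, g \<otimes> h) \<in> (cayley_edges G S)\<^sup>*"
  using assms
proof (induction h arbitrary: g rule: generate.induct)
  case (incl h)
  then show ?case unfolding cayley_edges_def by blast
next
  case (inv h)
  then have "inv h \<in> S" using gen by (auto simp: finite_symmetric_generating_set_def)
  then show ?case using inv unfolding cayley_edges_def by blast
next
  case (eng h1 h2)
  have c: "h1 \<in> carrier G" "h2 \<in> carrier G"
    using eng gen generate_in_carrier[of S] by (auto simp: finite_symmetric_generating_set_def)
  have "(g, g \<otimes> h1) \<in> (cayley_edges G S)\<^sup>*" "(g \<otimes> h1, g \<otimes> h1 \<otimes> h2) \<in> (cayley_edges G S)\<^sup>*"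
    using eng c by auto
  then show ?case using c eng.prems m_assoc[of g h1 h2] by (metis rtrancl_trans)
qed auto

lemma cayley_connected:
  assumes "g \<in> carrier G" "h \<in> carrier G"
  shows "\<exists>n. (g, h) \<in> cayley_edges G S ^^ n"
proof -
  have "inv g \<otimes> h \<in> generate G S"
    using assms gen by (simp add: finite_symmetric_generating_set_def)
  moreover have e: "g \<otimes> (inv g \<otimes> h) = h"
    using assms m_assoc[of g "inv g" h] by simp
  ultimately have p: "(g, g \<otimes> (inv g \<otimes> h)) \<in> (cayley_edges G S)\<^sup>*"
    using assms(1) by (intro cayley_path_translate)
  have "(g, h) \<in> (cayley_edges G S)\<^sup>*"
    using p unfolding e .
  then show ?thesis by (simp add: rtrancl_power)
qed

lemma relpow_sym: "sym R \<Longrightarrow> (x, y) \<in> R ^^ n \<Longrightarrow> (y, x) \<in> R ^^ n"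
proof (induction n arbitrary: y)
  case (Suc n)
  then obtain z where "(x, z) \<in> R ^^ n" "(z, y) \<in> R" by auto
  then show ?case using Suc by (metis relpow_Suc_I2 symD)
qed auto

lemma Metric_space_cayley: "Metric_space (carrier G) (cayley_dist G S)"
proof
  fix x y z
  show "0 \<le> cayley_dist G S x y" by (simp add: cayley_dist_def)
  show "cayley_dist G S x y = cayley_dist G S y x"
    using relpow_sym[OF cayley_edges_sym] unfolding cayley_dist_def by metis
  assume x: "x \<in> carrier G" and y: "y \<in> carrier G"
  show "(cayley_dist G S x y = 0) = (x = y)"
  proof
    assume "cayley_dist G S x y = 0"
    then have "(LEAST n. (x, y) \<in> cayley_edges G S ^^ n) = 0" by (simp add: cayley_dist_def)
    then show "x = y" using LeastI_ex[OF cayley_connected[OF x y]] by simp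
  next
    assume "x = y"
    then show "cayley_dist G S x y = 0" by (auto simp: cayley_dist_def intro!: Least_eq_0)
  qed
  assume z: "z \<in> carrier G"
  have "(x, z) \<in> cayley_edges G S ^^ ((LEAST n. (x, y) \<in> cayley_edges G S ^^ n)
          + (LEAST n. (y, z) \<in> cayley_edges G S ^^ n))"
    using LeastI_ex[OF cayley_connected[OF x y]] LeastI_ex[OF cayley_connected[OF y z]]
    by (auto simp: relpow_add)
  then show "cayley_dist G S x z \<le> cayley_dist G S x y + cayley_dist G S y z"
    unfolding cayley_dist_def of_nat_add[symmetric] of_nat_le_iff by (rule Least_le)
qed

end

end

theory Submission
  imports Defs
begin

text \<open>
  The convolution kernels are controlled by right ideals: since \<open>(f \<star> x) \<star> y = f \<star> (x \<star> y)\<close>, the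
  elements of \<open>\<real>[G]\<close> that annihilate a given function form a right ideal, and so does the set
  \<open>I\<close> of all elements that annihilate the whole of \<open>X \<oplus> constants\<close>. Two facts give the theorem.

  Duality: \<open>I\<close> determines \<open>X\<close> among the Lipschitz functions. If a function \<open>f\<close> vanishing at the
  unit is not in \<open>X\<close>, pointwise closedness yields a finite set of points on which no member of
  \<open>X\<close> agrees with \<open>f\<close>, and linear algebra on these points yields a finitely supported functional
  that vanishes on \<open>X\<close> but not at \<open>f\<close>. Changing its weight at the unit, where all these functions
  are \<open>0\<close>, makes it vanish on constants too. Read through \<open>h \<mapsto> inv h\<close> it is an element of
  \<open>\<real>[G]\<close>; its convolution with \<open>X\<close> vanishes at the unit, and by translation invariance everywhere.
  This is \<open>annihilator_separates\<close>.

  Finiteness: \<open>I\<close> is generated by finitely many elements, because \<open>\<real>[G]\<close> is right Noetherian for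
  polycyclic \<open>G\<close> (Hall), \<open>polycyclic_right_noetherian\<close>. One climbs the polycyclic series;
  if \<open>K\<close> is generated by a normal subgroup \<open>H\<close> and an element \<open>t\<close>, then \<open>\<real>[K]\<close> consists of the
  Laurent expressions \<open>\<Sum>i. a\<^sub>i t\<^sup>i\<close> with \<open>a\<^sub>i \<in> \<real>[H]\<close>, and Hilbert's argument with leading
  coefficients applies. It never uses that the expression is unique, so that finite and infinite
  quotients \<open>K/H\<close> are treated at once.
\<close>

section \<open>Right submodules of the group algebra\<close>

text \<open>
  For a subgroup \<open>H\<close>, \<open>finite_support H\<close> is the group algebra \<open>\<real>[H]\<close>. Its elements are extended by
  \<open>0\<close> rather than by \<open>undefined\<close>, so that the algebras of all subgroups lie in one function space.
\<close>
definition finite_support :: "'a set \<Rightarrow> ('a \<Rightarrow> real) set" where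
  "finite_support A = {x. finite {g. x g \<noteq> 0} \<and> {g. x g \<noteq> 0} \<subseteq> A}"

text \<open>Right multiplication by the group element \<open>k\<close>: it moves the point mass at \<open>a\<close> to \<open>a k\<close>.\<close>
definition right_translate ::
    "('a, 'b) monoid_scheme \<Rightarrow> ('a \<Rightarrow> real) \<Rightarrow> 'a \<Rightarrow> 'a \<Rightarrow> real" where
  "right_translate G x k = (\<lambda>g. if g \<in> carrier G then x (g \<otimes>\<^bsub>G\<^esub> inv\<^bsub>G\<^esub> k) else 0)"

text \<open>
  The right ideals of \<open>\<real>[H]\<close>. As \<open>\<real>[H]\<close> is spanned by \<open>H\<close>, closure under right multiplication
  by \<open>\<real>[H]\<close> amounts to being a linear subspace closed under right translation by \<open>H\<close>.
\<close>
definition right_submodule ::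
    "('a, 'b) monoid_scheme \<Rightarrow> 'a set \<Rightarrow> ('a \<Rightarrow> real) set \<Rightarrow> bool" where
  "right_submodule G H M \<longleftrightarrow>
     M \<subseteq> finite_support H \<and> (\<lambda>_. 0) \<in> M \<and>
     (\<forall>x\<in>M. \<forall>y\<in>M. \<forall>c. (\<lambda>g. x g + c * y g) \<in> M) \<and>
     (\<forall>x\<in>M. \<forall>h\<in>H. right_translate G x h \<in> M)"

text \<open>
  Every right ideal is finitely generated; that \<open>F\<close> generates \<open>M\<close> is expressed by the minimality
  of \<open>M\<close> among the right ideals containing \<open>F\<close>, which avoids linear combinations.
\<close>
definition right_noetherian :: "('a, 'b) monoid_scheme \<Rightarrow> 'a set \<Rightarrow> bool" where
  "right_noetherian G H \<longleftrightarrow>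
     (\<forall>M. right_submodule G H M \<longrightarrow>
        (\<exists>F. finite F \<and> F \<subseteq> M \<and> (\<forall>N. right_submodule G H N \<and> F \<subseteq> N \<longrightarrow> M \<subseteq> N)))"

lemma finite_support_mono: "A \<subseteq> B \<Longrightarrow> finite_support A \<subseteq> finite_support B"
  by (auto simp: finite_support_def)

lemma finite_support_zero: "(\<lambda>_. 0) \<in> finite_support A"
  by (simp add: finite_support_def)

lemma finite_support_linear:
  assumes "x \<in> finite_support A" "y \<in> finite_support A"
  shows "(\<lambda>g. x g + c * y g) \<in> finite_support A"
proof -
  have "{g. x g + c * y g \<noteq> 0} \<subseteq> {g. x g \<noteq> 0} \<union> {g. y g \<noteq> 0}" by auto
  with assms show ?thesis
    unfolding finite_support_def by (auto intro: finite_subset)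
qed

lemma right_submoduleD:
  assumes "right_submodule G H M"
  shows "x \<in> M \<Longrightarrow> x \<in> finite_support H" "(\<lambda>_. 0) \<in> M"
    "x \<in> M \<Longrightarrow> y \<in> M \<Longrightarrow> (\<lambda>g. x g + c * y g) \<in> M"
    "x \<in> M \<Longrightarrow> h \<in> H \<Longrightarrow> right_translate G x h \<in> M"
  using assms by (auto simp: right_submodule_def)

lemma right_noetherianE:
  assumes "right_noetherian G H" "right_submodule G H M"
  obtains F where "finite F" "F \<subseteq> M"
    "\<And>N. right_submodule G H N \<Longrightarrow> F \<subseteq> N \<Longrightarrow> M \<subseteq> N"
proof -
  obtain F where F: "finite F" "F \<subseteq> M" "\<forall>N. right_submodule G H N \<and> F \<subseteq> N \<longrightarrow> M \<subseteq> N"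
    using assms(1)[unfolded right_noetherian_def, THEN spec, THEN mp, OF assms(2)]
    by (elim exE conjE)
  show thesis by (rule that[OF F(1,2)]) (simp add: F(3))
qed

lemma right_submodule_Inter:
  assumes "\<M> \<noteq> {}" "\<And>M. M \<in> \<M> \<Longrightarrow> right_submodule G H M"
  shows "right_submodule G H (\<Inter>\<M>)"
  using assms unfolding right_submodule_def by blast

lemma right_translate_linear:
  "right_translate G (\<lambda>g. x g + c * y g) k =
     (\<lambda>g. right_translate G x k g + c * right_translate G y k g)"
  by (auto simp: right_translate_def)

context group
begin

lemma right_translate_mult:
  assumes "h \<in> carrier G" "k \<in> carrier G"
  shows "right_translate G (right_translate G x h) k = right_translate G x (h \<otimes> k)"
  using assms by (auto simp: right_translate_def inv_mult_group m_assoc)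

lemma right_translate_one:
  "x \<in> finite_support (carrier G) \<Longrightarrow> right_translate G x \<one> = x"
  by (auto simp: right_translate_def finite_support_def fun_eq_iff)

lemma right_translate_finite_support:
  assumes "x \<in> finite_support A" "A \<subseteq> carrier G" "k \<in> carrier G"
    and "\<And>a. a \<in> A \<Longrightarrow> x a \<noteq> 0 \<Longrightarrow> a \<otimes> k \<in> B"
  shows "right_translate G x k \<in> finite_support B"
proof -
  have eq: "{g. right_translate G x k g \<noteq> 0} = (\<lambda>a. a \<otimes> k) ` {a. x a \<noteq> 0}"
  proof (intro equalityI subsetI)
    fix g assume "g \<in> {g. right_translate G x k g \<noteq> 0}"
    then have g: "g \<in> carrier G" "x (g \<otimes> inv k) \<noteq> 0"
      by (auto simp: right_translate_def split: if_splits)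
    then show "g \<in> (\<lambda>a. a \<otimes> k) ` {a. x a \<noteq> 0}"
      using assms(3) by (intro image_eqI[of _ _ "g \<otimes> inv k"]) (auto simp: m_assoc)
  next
    fix g assume "g \<in> (\<lambda>a. a \<otimes> k) ` {a. x a \<noteq> 0}"
    then obtain a where a: "g = a \<otimes> k" "x a \<noteq> 0" by auto
    then have "a \<in> carrier G" using assms(1,2) by (auto simp: finite_support_def)
    then show "g \<in> {g. right_translate G x k g \<noteq> 0}"
      using a assms(3) by (auto simp: right_translate_def m_assoc)
  qed
  show ?thesis
    using assms unfolding finite_support_def mem_Collect_eq eq by auto
qed

end

section \<open>Hall's theorem: the Hilbert basis argument\<close>

locale cyclic_extension = group G for G :: "('a, 'b) monoid_scheme" (structure) +
  fixes H K :: "'a set" and t :: 'a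
  assumes subH: "subgroup H G" and subK: "subgroup K G" and HK: "H \<subseteq> K"
    and conj_closed: "\<And>k h. k \<in> K \<Longrightarrow> h \<in> H \<Longrightarrow> k \<otimes> h \<otimes> inv k \<in> H"
    and tK: "t \<in> K"
    and cosets: "\<And>k. k \<in> K \<Longrightarrow> \<exists>(m::nat) (i::nat). \<exists>h\<in>H. k \<otimes> t [^] m = h \<otimes> t [^] i"
begin

text \<open>The points over which expressions \<open>\<Sum>i<j. a\<^sub>i t\<^sup>i\<close> with \<open>a\<^sub>i \<in> \<real>[H]\<close> are supported.\<close>
definition below :: "nat \<Rightarrow> 'a set" where
  "below j = {h \<otimes> t [^] i | h i. h \<in> H \<and> i < j}"

text \<open>
  The \<open>a \<in> \<real>[H]\<close> for which \<open>M\<close> contains an element of the form \<open>a t\<^sup>j\<close> plus terms of lower degree.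
  If \<open>K/H\<close> is finite, the cosets \<open>H t\<^sup>i\<close> repeat and an element has no well-defined leading
  coefficient; the existential form makes sense regardless.
\<close>
definition leading :: "nat \<Rightarrow> ('a \<Rightarrow> real) set \<Rightarrow> ('a \<Rightarrow> real) set" where
  "leading j M = {a \<in> finite_support H.
     \<exists>y\<in>M. (\<lambda>g. y g + (-1) * right_translate G a (t [^] j) g) \<in> finite_support (below j)}"

lemma K_carrier: "k \<in> K \<Longrightarrow> k \<in> carrier G"
  using subK by (rule subgroup.mem_carrier)

lemma H_carrier: "h \<in> H \<Longrightarrow> h \<in> carrier G"
  using HK K_carrier by auto

lemma t_pow_K: "t [^] (j::nat) \<in> K"
  by (induction j) (use subK tK in \<open>auto intro: subgroup.one_closed subgroup.m_closed\<close>)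

lemma t_carrier [simp]: "t \<in> carrier G"
  using tK K_carrier by blast

lemma below_K: "below j \<subseteq> K"
  unfolding below_def using subK HK t_pow_K by (auto intro!: subgroup.m_closed)

lemma below_carrier: "below j \<subseteq> carrier G"
  using below_K K_carrier by blast

lemma below_mono: "i \<le> j \<Longrightarrow> below i \<subseteq> below j"
  unfolding below_def by (auto intro: less_le_trans)

lemma below_mult_t: "b \<in> below j \<Longrightarrow> b \<otimes> t \<in> below (Suc j)"
proof -
  assume "b \<in> below j"
  then obtain h i where h: "b = h \<otimes> t [^] i" "h \<in> H" "i < j" by (auto simp: below_def)
  then have "b \<otimes> t = h \<otimes> t [^] Suc i"
    using H_carrier by (simp add: m_assoc)
  then show ?thesis unfolding below_def using h by (auto intro!: exI[of _ "Suc i"] simp del: nat_pow_Suc)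
qed

text \<open>Normality moves \<open>k\<close> past the power of \<open>t\<close>: \<open>t\<^sup>i k = (t\<^sup>i k inv (t\<^sup>i)) t\<^sup>i\<close>.\<close>
lemma below_mult_H:
  assumes "b \<in> below j" "k \<in> H"
  shows "b \<otimes> k \<in> below j"
proof -
  obtain h i where h: "b = h \<otimes> t [^] i" "h \<in> H" "i < j"
    using assms by (auto simp: below_def)
  let ?s = "t [^] i"
  have c: "?s \<in> carrier G" "k \<in> carrier G" "h \<in> carrier G"
    using assms h H_carrier by auto
  have "?s \<otimes> k \<otimes> inv ?s \<in> H" using conj_closed t_pow_K assms by blast
  then have "h \<otimes> (?s \<otimes> k \<otimes> inv ?s) \<in> H"
    using h subH subgroup.m_closed by metis
  moreover have "b \<otimes> k = h \<otimes> (?s \<otimes> k \<otimes> inv ?s) \<otimes> ?s"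
    using c by (simp add: h m_assoc)
  ultimately show ?thesis unfolding below_def using h(3) by blast
qed

text \<open>
  To multiply a leading coefficient by \<open>h\<close> on the right, multiply the element of \<open>M\<close> by the
  conjugate \<open>k = inv (t\<^sup>j) h t\<^sup>j\<close>, since \<open>a t\<^sup>j k = a h t\<^sup>j\<close>.
\<close>
lemma leading_submodule:
  assumes M: "right_submodule G K M"
  shows "right_submodule G H (leading j M)"
  unfolding right_submodule_def
proof (intro conjI ballI allI)
  show "leading j M \<subseteq> finite_support H" by (auto simp: leading_def)
  show "(\<lambda>_. 0) \<in> leading j M"
    unfolding leading_def
    by (auto intro!: bexI[of _ "\<lambda>_. 0"] right_submoduleD(2)[OF M]
        simp: finite_support_zero right_translate_def)
next
  fix a b c assume "a \<in> leading j M" "b \<in> leading j M"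
  then obtain y z where a: "a \<in> finite_support H" "y \<in> M"
      "(\<lambda>g. y g + (-1) * right_translate G a (t [^] j) g) \<in> finite_support (below j)"
    and b: "b \<in> finite_support H" "z \<in> M"
      "(\<lambda>g. z g + (-1) * right_translate G b (t [^] j) g) \<in> finite_support (below j)"
    by (auto simp: leading_def)
  have "(\<lambda>g. (y g + c * z g) +
      (-1) * right_translate G (\<lambda>g. a g + c * b g) (t [^] j) g) \<in> finite_support (below j)"
    using finite_support_linear[OF a(3) b(3), of c]
    by (simp add: right_translate_linear algebra_simps)
  then show "(\<lambda>g. a g + c * b g) \<in> leading j M"
    unfolding leading_def mem_Collect_eq
    by (intro conjI bexI[of _ "\<lambda>g. y g + c * z g"] finite_support_linear[OF a(1) b(1)]
        right_submoduleD(3)[OF M a(2) b(2)])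
next
  fix a h assume "a \<in> leading j M" and h: "h \<in> H"
  then obtain y where a: "a \<in> finite_support H" "y \<in> M"
      "(\<lambda>g. y g + (-1) * right_translate G a (t [^] j) g) \<in> finite_support (below j)"
    by (auto simp: leading_def)
  let ?s = "t [^] j"
  define k where "k = inv ?s \<otimes> h \<otimes> ?s"
  have c: "?s \<in> carrier G" "h \<in> carrier G" using h H_carrier by auto
  have "inv ?s \<in> K" using subK t_pow_K by (rule subgroup.m_inv_closed)
  from conj_closed[OF this h] have k: "k \<in> H" unfolding k_def using c by simp
  have sk: "?s \<otimes> k = h \<otimes> ?s" unfolding k_def using c by (simp add: m_assoc[symmetric])
  have ah: "right_translate G a h \<in> finite_support H"
    using a(1) H_carrier h subH
    by (auto intro!: right_translate_finite_support[where A=H] subgroup.m_closed)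
  have "right_translate G (\<lambda>g. y g + (-1) * right_translate G a ?s g) k
      \<in> finite_support (below j)"
    using a(3) below_carrier k H_carrier below_mult_H
    by (auto intro!: right_translate_finite_support[where A="below j"])
  also have "right_translate G (\<lambda>g. y g + (-1) * right_translate G a ?s g) k =
     (\<lambda>g. right_translate G y k g + (-1) * right_translate G (right_translate G a h) ?s g)"
    using c k H_carrier unfolding right_translate_linear
    by (simp add: right_translate_mult sk)
  finally show "right_translate G a h \<in> leading j M"
    unfolding leading_def using ah right_submoduleD(4)[OF M a(2), of k] k HK by blast
qed

lemma leading_mono_set: "M \<subseteq> N \<Longrightarrow> leading j M \<subseteq> leading j N"
  by (auto simp: leading_def)

text \<open>
  Multiplying by \<open>t\<close> on the right raises degrees without changing coefficients, as these stand on
  the left.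
\<close>
lemma leading_Suc:
  assumes M: "right_submodule G K M"
  shows "leading j M \<subseteq> leading (Suc j) M"
proof
  fix a assume "a \<in> leading j M"
  then obtain y where a: "a \<in> finite_support H" "y \<in> M"
      "(\<lambda>g. y g + (-1) * right_translate G a (t [^] j) g) \<in> finite_support (below j)"
    by (auto simp: leading_def)
  have "right_translate G (\<lambda>g. y g + (-1) * right_translate G a (t [^] j) g) t
      \<in> finite_support (below (Suc j))"
    using a(3) below_carrier below_mult_t
    by (auto intro!: right_translate_finite_support[where A="below j"])
  also have "right_translate G (\<lambda>g. y g + (-1) * right_translate G a (t [^] j) g) t =
     (\<lambda>g. right_translate G y t g + (-1) * right_translate G a (t [^] Suc j) g)"
    unfolding right_translate_linear by (simp add: right_translate_mult)
  finally show "a \<in> leading (Suc j) M"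
    unfolding leading_def using a right_submoduleD(4)[OF M a(2) tK] by blast
qed

lemma leading_mono:
  assumes "right_submodule G K M" "i \<le> j"
  shows "leading i M \<subseteq> leading j M"
  using assms(2) leading_Suc[OF assms(1)] by (rule lift_Suc_mono_le[rotated])

text \<open>
  The part of \<open>x\<close> over the top coset \<open>H t\<^sup>j\<close> serves as leading term, whether or not this coset has
  points in common with the lower ones.
\<close>
lemma leading_coefficient_exists:
  assumes "x \<in> M" "x \<in> finite_support (below (Suc j))"
  shows "\<exists>a \<in> leading j M.
    (\<lambda>g. x g + (-1) * right_translate G a (t [^] j) g) \<in> finite_support (below j)"
proof -
  let ?s = "t [^] j"
  define C where "C = {h \<otimes> ?s | h. h \<in> H}"
  define r where "r = (\<lambda>g. if g \<in> C then x g else 0)"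
  define a where "a = right_translate G r (inv ?s)"
  have C: "C \<subseteq> carrier G" unfolding C_def using H_carrier by auto
  have x: "finite {g. x g \<noteq> 0}" "{g. x g \<noteq> 0} \<subseteq> below (Suc j)"
    using assms(2) by (auto simp: finite_support_def)
  have r: "r \<in> finite_support C"
    unfolding finite_support_def r_def by (auto intro: finite_subset[OF _ x(1)])
  have a: "a \<in> finite_support H"
    unfolding a_def using r C H_carrier
    by (intro right_translate_finite_support[where A=C]) (auto simp: C_def m_assoc)
  have as: "right_translate G a ?s = r"
    unfolding a_def using r finite_support_mono[OF C] right_translate_one[of r]
    by (auto simp: right_translate_mult)
  have "below (Suc j) \<subseteq> below j \<union> C"
    unfolding below_def C_def by (auto simp: less_Suc_eq)
  then have "(\<lambda>g. x g + (-1) * right_translate G a ?s g) \<in> finite_support (below j)"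
    unfolding as r_def finite_support_def using x(2) by (auto intro: finite_subset[OF _ x(1)])
  then show ?thesis
    unfolding leading_def using a assms(1) by blast
qed

text \<open>
  Elements of nonnegative degree are reduced by subtracting an element of \<open>N\<close> with the same leading
  coefficient. A general element is first shifted into this range by a power of \<open>t\<close>, which is
  invertible in \<open>K\<close>.
\<close>
lemma submodule_le_if_leading_le:
  assumes M: "right_submodule G K M" and N: "right_submodule G K N" and "N \<subseteq> M"
    and le: "\<And>j. leading j M \<subseteq> leading j N"
  shows "M \<subseteq> N"
proof -
  have positive: "x \<in> M \<Longrightarrow> x \<in> finite_support (below j) \<Longrightarrow> x \<in> N" for x j
  proof (induction j arbitrary: x)
    case 0
    then have "x = (\<lambda>_. 0)" by (auto simp: finite_support_def below_def)
    then show ?case using right_submoduleD(2)[OF N] by simp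
  next
    case (Suc j)
    obtain a where a: "a \<in> leading j M"
        "(\<lambda>g. x g + (-1) * right_translate G a (t [^] j) g) \<in> finite_support (below j)"
      using leading_coefficient_exists[OF Suc.prems] by blast
    then obtain y where y: "y \<in> N"
        "(\<lambda>g. y g + (-1) * right_translate G a (t [^] j) g) \<in> finite_support (below j)"
      using le by (auto simp: leading_def)
    have "(\<lambda>g. x g + (-1) * y g) \<in> finite_support (below j)"
      using finite_support_linear[OF a(2) y(2), of "-1"] by simp
    moreover have "(\<lambda>g. x g + (-1) * y g) \<in> M"
      using right_submoduleD(3)[OF M Suc.prems(1)] y(1) \<open>N \<subseteq> M\<close> by blast
    ultimately have "(\<lambda>g. x g + (-1) * y g) \<in> N" using Suc.IH by blast
    then show ?case using right_submoduleD(3)[OF N _ y(1), of _ 1] by fastforce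
  qed
  show ?thesis
  proof
    fix x assume x: "x \<in> M"
    have supp: "finite {g. x g \<noteq> 0}" "{g. x g \<noteq> 0} \<subseteq> K"
      using right_submoduleD(1)[OF M x] by (auto simp: finite_support_def)
    have "\<forall>g\<in>{g. x g \<noteq> 0}.
        eventually (\<lambda>m. \<exists>i. \<exists>h\<in>H. g \<otimes> t [^] m = h \<otimes> t [^] (i::nat)) sequentially"
    proof
      fix g assume "g \<in> {g. x g \<noteq> 0}"
      then have g: "g \<in> K" "g \<in> carrier G" using supp K_carrier by auto
      obtain m i h where h: "h \<in> H" "g \<otimes> t [^] (m::nat) = h \<otimes> t [^] (i::nat)"
        using cosets[OF g(1)] by blast
      have "g \<otimes> t [^] (m + n) = h \<otimes> t [^] (i + n)" for n
        using h g(2) H_carrier by (simp add: nat_pow_mult[symmetric] m_assoc[symmetric])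
      then show "eventually (\<lambda>m. \<exists>i. \<exists>h\<in>H. g \<otimes> t [^] m = h \<otimes> t [^] (i::nat)) sequentially"
        unfolding eventually_sequentially using h(1) by (auto simp: le_iff_add)
    qed
    from eventually_happens'[OF sequentially_bot eventually_ball_finite[OF supp(1) this]]
    obtain m where m: "\<forall>g\<in>{g. x g \<noteq> 0}. \<exists>i. \<exists>h\<in>H. g \<otimes> t [^] (m::nat) = h \<otimes> t [^] (i::nat)"
      by (elim exE)
    have "\<forall>g\<in>{g. x g \<noteq> 0}. eventually (\<lambda>j. g \<otimes> t [^] m \<in> below j) sequentially"
    proof
      fix g assume "g \<in> {g. x g \<noteq> 0}"
      then obtain i h where "h \<in> H" "g \<otimes> t [^] m = h \<otimes> t [^] (i::nat)" using m by blast
      then have "g \<otimes> t [^] m \<in> below (Suc i)" unfolding below_def by auto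
      then show "eventually (\<lambda>j. g \<otimes> t [^] m \<in> below j) sequentially"
        unfolding eventually_sequentially using below_mono by blast
    qed
    from eventually_happens'[OF sequentially_bot eventually_ball_finite[OF supp(1) this]]
    obtain j where j: "\<forall>g\<in>{g. x g \<noteq> 0}. g \<otimes> t [^] m \<in> below j"
      by (elim exE)
    let ?s = "t [^] m"
    have fin: "x \<in> finite_support K" using right_submoduleD(1)[OF M x] .
    have "right_translate G x ?s \<in> finite_support (below j)"
      using j K_carrier by (intro right_translate_finite_support[OF fin]) auto
    moreover have "right_translate G x ?s \<in> M"
      using right_submoduleD(4)[OF M x t_pow_K] .
    ultimately have "right_translate G x ?s \<in> N" by (rule positive[rotated])
    then have "right_translate G (right_translate G x ?s) (inv ?s) \<in> N"
      using right_submoduleD(4)[OF N] subgroup.m_inv_closed[OF subK t_pow_K] by simp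
    moreover have "right_translate G (right_translate G x ?s) (inv ?s) = x"
      using right_translate_one[of x] fin finite_support_mono[of K "carrier G"]
        subgroup.subset[OF subK] by (simp add: right_translate_mult subset_iff)
    ultimately show "x \<in> N" by simp
  qed
qed

text \<open>
  Hilbert's basis argument. The ideals of leading coefficients increase with the degree; their union
  is finitely generated, so they are constant from some degree \<open>n\<close> on. Elements of \<open>M\<close> that realise
  finitely many generators of each of the ideals up to degree \<open>n\<close> then generate \<open>M\<close>.
\<close>
theorem right_noetherian_extension:
  assumes noeth: "right_noetherian G H"
  shows "right_noetherian G K"
  unfolding right_noetherian_def
proof (intro allI impI)
  fix M assume M: "right_submodule G K M"
  note mono = leading_mono[OF M]
  have union: "right_submodule G H (\<Union>j. leading j M)"
    unfolding right_submodule_def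
  proof (intro conjI ballI allI)
    fix x y c assume "x \<in> (\<Union>j. leading j M)" "y \<in> (\<Union>j. leading j M)"
    then obtain i j where "x \<in> leading i M" "y \<in> leading j M" by auto
    then have "x \<in> leading (max i j) M" "y \<in> leading (max i j) M"
      using mono[of i "max i j"] mono[of j "max i j"] by auto
    then show "(\<lambda>g. x g + c * y g) \<in> (\<Union>j. leading j M)"
      using right_submoduleD(3)[OF leading_submodule[OF M]] by blast
  next
    show "(\<Union>j. leading j M) \<subseteq> finite_support H" by (auto simp: leading_def)
    show "(\<lambda>_. 0) \<in> (\<Union>j. leading j M)"
      using right_submoduleD(2)[OF leading_submodule[OF M]] by blast
  next
    fix x h assume "x \<in> (\<Union>j. leading j M)" "h \<in> H"
    then show "right_translate G x h \<in> (\<Union>j. leading j M)"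
      using right_submoduleD(4)[OF leading_submodule[OF M]] by blast
  qed
  obtain A where A: "finite A" "A \<subseteq> (\<Union>j. leading j M)"
    "\<And>N. right_submodule G H N \<Longrightarrow> A \<subseteq> N \<Longrightarrow> (\<Union>j. leading j M) \<subseteq> N"
    using right_noetherianE[OF noeth union] by blast
  have "\<forall>a\<in>A. eventually (\<lambda>j. a \<in> leading j M) sequentially"
  proof
    fix a assume "a \<in> A"
    then obtain i where "a \<in> leading i M" using A(2) by auto
    then show "eventually (\<lambda>j. a \<in> leading j M) sequentially"
      unfolding eventually_sequentially using mono[of i] by (intro exI[of _ i]) auto
  qed
  from eventually_happens'[OF sequentially_bot eventually_ball_finite[OF A(1) this]]
  obtain n where "A \<subseteq> leading n M" by auto
  then have stable: "leading j M \<subseteq> leading n M" for j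
    using A(3)[OF leading_submodule[OF M], of n] by auto
  have "\<exists>F. finite F \<and> F \<subseteq> M \<and>
      (\<forall>N. right_submodule G K N \<and> F \<subseteq> N \<longrightarrow> leading j M \<subseteq> leading j N)" for j
  proof -
    obtain B where B: "finite B" "B \<subseteq> leading j M"
      "\<And>N. right_submodule G H N \<Longrightarrow> B \<subseteq> N \<Longrightarrow> leading j M \<subseteq> N"
      using right_noetherianE[OF noeth leading_submodule[OF M], of j] by blast
    have "\<forall>a\<in>B. \<exists>y\<in>M. a \<in> leading j {y}"
      using B(2) by (auto simp: leading_def)
    then obtain lift where lift: "\<And>a. a \<in> B \<Longrightarrow> lift a \<in> M \<and> a \<in> leading j {lift a}"
      by metis
    have "leading j M \<subseteq> leading j N" if N: "right_submodule G K N" "lift ` B \<subseteq> N" for N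
    proof (rule B(3)[OF leading_submodule[OF N(1)]])
      show "B \<subseteq> leading j N"
        using lift leading_mono_set[of "{lift _}" N j] N(2) by blast
    qed
    then show ?thesis using B(1) lift by (intro exI[of _ "lift ` B"]) auto
  qed
  then obtain F where F: "\<And>j. finite (F j)" "\<And>j. F j \<subseteq> M"
    "\<And>j N. right_submodule G K N \<Longrightarrow> F j \<subseteq> N \<Longrightarrow> leading j M \<subseteq> leading j N"
    by metis
  show "\<exists>F. finite F \<and> F \<subseteq> M \<and> (\<forall>N. right_submodule G K N \<and> F \<subseteq> N \<longrightarrow> M \<subseteq> N)"
  proof (intro exI[of _ "\<Union>j\<le>n. F j"] conjI allI impI)
    show "finite (\<Union>j\<le>n. F j)" "(\<Union>j\<le>n. F j) \<subseteq> M" using F by auto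
    fix N assume N: "right_submodule G K N \<and> (\<Union>j\<le>n. F j) \<subseteq> N"
    \<comment> \<open>The comparison of leading coefficients requires a submodule of \<open>M\<close>.\<close>
    have MN: "right_submodule G K (\<Inter>{M, N})"
      using M N by (intro right_submodule_Inter) auto
    have low: "leading j M \<subseteq> leading j (\<Inter>{M, N})" if "j \<le> n" for j
      using that N F by (intro F(3)[OF MN]) auto
    have "leading j M \<subseteq> leading j (\<Inter>{M, N})" for j
    proof (cases "j \<le> n")
      case False
      then show ?thesis
        using stable[of j] low[of n] leading_mono[OF MN, of n j] by auto
    qed (rule low)
    then have "M \<subseteq> \<Inter>{M, N}"
      by (intro submodule_le_if_leading_le[OF M MN]) auto
    then show "M \<subseteq> N" by blast
  qed
qed

end

context group
begin

text \<open>\<open>\<real>[{\<one>}]\<close> is the field \<open>\<real>\<close>: any nonzero element generates it.\<close>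
lemma right_noetherian_trivial: "right_noetherian G {\<one>}"
  unfolding right_noetherian_def
proof (intro allI impI)
  fix M assume M: "right_submodule G {\<one>} M"
  show "\<exists>F. finite F \<and> F \<subseteq> M \<and> (\<forall>N. right_submodule G {\<one>} N \<and> F \<subseteq> N \<longrightarrow> M \<subseteq> N)"
  proof (cases "\<exists>x\<in>M. x \<one> \<noteq> 0")
    case True
    then obtain x where x: "x \<in> M" "x \<one> \<noteq> 0" by blast
    have "y \<in> N" if N: "right_submodule G {\<one>} N" "x \<in> N" and y: "y \<in> M" for y N
    proof -
      have "y = (\<lambda>g. 0 + (y \<one> / x \<one>) * x g)"
      proof
        fix g
        have "y g = 0 \<and> x g = 0" if "g \<noteq> \<one>"
          using right_submoduleD(1)[OF M y] right_submoduleD(1)[OF M x(1)] that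
          by (auto simp: finite_support_def)
        then show "y g = 0 + (y \<one> / x \<one>) * x g"
          using x(2) by (cases "g = \<one>") simp_all
      qed
      then show ?thesis
        using right_submoduleD(3)[OF N(1) right_submoduleD(2)[OF N(1)] N(2), of "y \<one> / x \<one>"]
        by simp
    qed
    then show ?thesis using x by (intro exI[of _ "{x}"]) auto
  next
    case False
    then have "M \<subseteq> {\<lambda>_. 0}"
      using right_submoduleD(1)[OF M] by (fastforce simp: finite_support_def)
    then have "M \<subseteq> N" if "right_submodule G {\<one>} N" for N
      using right_submoduleD(2)[OF that] by auto
    then show ?thesis by (intro exI[of _ "{}"]) simp
  qed
qed

text \<open>
  A representative \<open>t\<close> of a generator of \<open>K/H\<close> gives \<open>k = h t\<^sup>n\<close> with an integer \<open>n\<close>; for negative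
  \<open>n\<close> the power of \<open>t\<close> is moved to the left-hand side, so that only natural exponents occur.
\<close>
lemma cyclic_quotient_extension:
  assumes subH: "subgroup H G" and subK: "subgroup K G"
    and normal: "H \<lhd> (G\<lparr>carrier := K\<rparr>)" and cyc: "cyclic_group (G\<lparr>carrier := K\<rparr> Mod H)"
  shows "\<exists>t. cyclic_extension G H K t"
proof -
  let ?K = "G\<lparr>carrier := K\<rparr>"
  interpret K: group ?K using subK by (rule subgroup_imp_group)
  interpret N: normal H ?K by (rule normal)
  interpret Q: group "?K Mod H" by (rule N.factorgroup_is_group)
  have HK: "H \<subseteq> K" using N.subset by simp
  have Kc: "K \<subseteq> carrier G" using subK by (rule subgroup.subset)
  obtain q where q: "q \<in> carrier (?K Mod H)" "carrier (?K Mod H) = range (\<lambda>n::int. q [^]\<^bsub>?K Mod H\<^esub> n)"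
    using cyc Q.cyclic_group by auto
  obtain t where t: "t \<in> K" "q = H #>\<^bsub>?K\<^esub> t"
    using q(1) by (auto simp: FactGroup_def RCOSETS_def)
  have tc: "t \<in> carrier G" using t Kc by auto
  interpret hom: group_hom ?K "?K Mod H" "\<lambda>a. H #>\<^bsub>?K\<^esub> a"
    unfolding group_hom_def group_hom_axioms_def
    by (intro conjI K.group_axioms Q.group_axioms N.r_coset_hom_Mod)
  have cos: "\<exists>(m::nat) (i::nat). \<exists>h\<in>H. k \<otimes> t [^] m = h \<otimes> t [^] i" if k: "k \<in> K" for k
  proof -
    have kc: "k \<in> carrier G" using k Kc by auto
    have "H #>\<^bsub>?K\<^esub> k \<in> carrier (?K Mod H)" using k by (auto simp: FactGroup_def RCOSETS_def)
    then obtain n :: int where n: "H #>\<^bsub>?K\<^esub> k = q [^]\<^bsub>?K Mod H\<^esub> n" using q(2) by auto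
    have "q [^]\<^bsub>?K Mod H\<^esub> n = H #>\<^bsub>?K\<^esub> (t [^]\<^bsub>?K\<^esub> n)"
      using hom.hom_int_pow[of t n] t by simp
    with n have "H #>\<^bsub>?K\<^esub> k = H #>\<^bsub>?K\<^esub> (t [^]\<^bsub>?K\<^esub> n)" by simp
    moreover have "k \<in> H #>\<^bsub>?K\<^esub> k"
      using K.rcos_self[OF _ N.subgroup_axioms] k by simp
    ultimately obtain h where h: "h \<in> H" "k = h \<otimes> t [^]\<^bsub>?K\<^esub> n"
      by (auto simp: r_coset_def)
    have kn: "k = h \<otimes> t [^] n" using h int_pow_consistent[OF subK t(1)] by simp
    have hc: "h \<in> carrier G" using h(1) HK Kc by auto
    show ?thesis
    proof (cases "n \<ge> 0")
      case True
      then have "k \<otimes> t [^] (0::nat) = h \<otimes> t [^] nat n"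
        using kn kc tc hc int_pow_int[of G t "nat n"] by simp
      then show ?thesis using h(1) by blast
    next
      case False
      then have "t [^] nat (- n) = t [^] (- n)"
        using int_pow_int[of G t "nat (- n)"] by simp
      then have "k \<otimes> t [^] nat (- n) = h \<otimes> t [^] (0::nat)"
        using kn tc hc by (simp add: m_assoc int_pow_mult[symmetric])
      then show ?thesis using h(1) by blast
    qed
  qed
  have conj: "k \<otimes> h \<otimes> inv k \<in> H" if "k \<in> K" "h \<in> H" for k h
    using N.inv_op_closed2[of k h] that m_inv_consistent[OF subK] by simp
  show ?thesis
    by (intro exI[of _ t] cyclic_extension.intro cyclic_extension_axioms.intro is_group
        subH subK HK conj t(1) cos)
qed

theorem polycyclic_right_noetherian:
  assumes "polycyclic G"
  shows "right_noetherian G (carrier G)"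
proof -
  obtain m H where H: "H 0 = {\<one>}" "H m = carrier G" "\<And>i. i \<le> m \<Longrightarrow> subgroup (H i) G"
    "\<And>i. i < m \<Longrightarrow> H i \<lhd> (G\<lparr>carrier := H (Suc i)\<rparr>)"
    "\<And>i. i < m \<Longrightarrow> cyclic_group (G\<lparr>carrier := H (Suc i)\<rparr> Mod H i)"
    using assms unfolding polycyclic_def by blast
  have "i \<le> m \<Longrightarrow> right_noetherian G (H i)" for i
  proof (induction i)
    case 0
    then show ?case using H(1) right_noetherian_trivial by simp
  next
    case (Suc i)
    then obtain t where "cyclic_extension G (H i) (H (Suc i)) t"
      using cyclic_quotient_extension[of "H i" "H (Suc i)"] H by auto
    then show ?case
      using Suc by (auto intro: cyclic_extension.right_noetherian_extension)
  qed
  from this[of m] show ?thesis using H(2) by simp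
qed

end

section \<open>Duality between invariant subspaces and right ideals\<close>

text \<open>The \<open>x \<in> \<real>[G]\<close> with \<open>f \<star> x = 0\<close>.\<close>
definition annihilator ::
    "('a, 'b) monoid_scheme \<Rightarrow> ('a \<Rightarrow> real) \<Rightarrow> ('a \<Rightarrow> real) set" where
  "annihilator G f = {x \<in> finite_support (carrier G).
     \<forall>g\<in>carrier G. (\<Sum>h | x h \<noteq> 0. f (g \<otimes>\<^bsub>G\<^esub> inv\<^bsub>G\<^esub> h) * x h) = 0}"

lemma ker_P_iff_annihilator:
  assumes x: "x \<in> finite_support (carrier G)"
  shows "f \<in> ker_P G (restrict x (carrier G)) \<longleftrightarrow> f \<in> real_functions G \<and> x \<in> annihilator G f"
proof -
  have supp: "{h. h \<in> carrier G \<and> restrict x (carrier G) h \<noteq> 0} = {h. x h \<noteq> 0}"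
    using x by (auto simp: finite_support_def)
  have "(\<Sum>h | x h \<noteq> 0. f (g \<otimes>\<^bsub>G\<^esub> inv\<^bsub>G\<^esub> h) * restrict x (carrier G) h)
      = (\<Sum>h | x h \<noteq> 0. f (g \<otimes>\<^bsub>G\<^esub> inv\<^bsub>G\<^esub> h) * x h)" for g
    using x by (intro sum.cong) (auto simp: finite_support_def)
  then show ?thesis
    using x unfolding ker_P_def convolution_def annihilator_def supp
    by (auto simp: fun_eq_iff restrict_def)
qed

lemma sum_support_linear:
  fixes x y w :: "'a \<Rightarrow> real"
  assumes "finite {h. x h \<noteq> 0}" "finite {h. y h \<noteq> 0}"
  shows "(\<Sum>h | x h + c * y h \<noteq> 0. w h * (x h + c * y h)) =
    (\<Sum>h | x h \<noteq> 0. w h * x h) + c * (\<Sum>h | y h \<noteq> 0. w h * y h)"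
proof -
  let ?S = "{h. x h \<noteq> 0} \<union> {h. y h \<noteq> 0}"
  have "(\<Sum>h | x h + c * y h \<noteq> 0. w h * (x h + c * y h)) = (\<Sum>h\<in>?S. w h * (x h + c * y h))"
    using assms by (intro sum.mono_neutral_left) auto
  moreover have "(\<Sum>h | x h \<noteq> 0. w h * x h) = (\<Sum>h\<in>?S. w h * x h)"
    using assms by (intro sum.mono_neutral_left) auto
  moreover have "(\<Sum>h | y h \<noteq> 0. w h * y h) = (\<Sum>h\<in>?S. w h * y h)"
    using assms by (intro sum.mono_neutral_left) auto
  ultimately show ?thesis
    by (simp add: sum.distrib sum_distrib_left algebra_simps)
qed

text \<open>
  A vector outside a subspace of \<open>\<real>\<^sup>F\<close> is separated from it by a functional. By induction on \<open>F\<close>: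
  if some \<open>p \<in> X\<close> is nonzero at the new point \<open>b\<close>, then subtracting multiples of \<open>p\<close> reduces the
  problem to the members of \<open>X\<close> that vanish at \<open>b\<close>, and the weight at \<open>b\<close> is chosen to annihilate
  \<open>p\<close>. Closure is only required up to values on \<open>F\<close>, so that functions on a larger domain need not
  be restricted.
\<close>
lemma finite_dimensional_separation:
  fixes X :: "('a \<Rightarrow> real) set"
  assumes "finite F" "X \<noteq> {}"
    and "\<And>h k c. h \<in> X \<Longrightarrow> k \<in> X \<Longrightarrow> \<exists>l\<in>X. \<forall>a\<in>F. l a = h a + c * k a"
    and "\<And>h. h \<in> X \<Longrightarrow> \<exists>a\<in>F. h a \<noteq> f a"
  shows "\<exists>y. (\<forall>h\<in>X. (\<Sum>a\<in>F. h a * y a) = 0) \<and> (\<Sum>a\<in>F. f a * y a) \<noteq> 0"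
  using assms
proof (induction F arbitrary: X f rule: finite_induct)
  case empty
  then show ?case by auto
next
  case (insert b F)
  note lin = insert.prems(2)
  have sum_upd: "(\<Sum>a\<in>insert b F. u a * (y(b := v)) a) = u b * v + (\<Sum>a\<in>F. u a * y a)"
    for u y :: "'a \<Rightarrow> real" and v
  proof -
    have "(\<Sum>a\<in>F. u a * (y(b := v)) a) = (\<Sum>a\<in>F. u a * y a)"
      using insert.hyps by (intro sum.cong) auto
    then show ?thesis using insert.hyps by simp
  qed
  show ?case
  proof (cases "\<forall>h\<in>X. h b = 0")
    case True
    show ?thesis
    proof (cases "f b = 0")
      case False
      have "(\<Sum>a\<in>insert b F. u a * ((\<lambda>_. 0)(b := 1)) a) = u b" for u :: "'a \<Rightarrow> real"
        unfolding sum_upd by simp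
      then show ?thesis using True False by metis
    next
      case fb: True
      have "\<exists>y. (\<forall>h\<in>X. (\<Sum>a\<in>F. h a * y a) = 0) \<and> (\<Sum>a\<in>F. f a * y a) \<noteq> 0"
      proof (rule insert.IH)
        show "\<exists>l\<in>X. \<forall>a\<in>F. l a = h a + c * k a" if "h \<in> X" "k \<in> X" for h k c
          using lin[OF that] by blast
        show "\<exists>a\<in>F. h a \<noteq> f a" if "h \<in> X" for h
          using insert.prems(3)[OF that] True fb that by auto
      qed (rule insert.prems(1))
      then obtain y where y: "\<forall>h\<in>X. (\<Sum>a\<in>F. h a * y a) = 0" "(\<Sum>a\<in>F. f a * y a) \<noteq> 0"
        by blast
      then show ?thesis by (intro exI[of _ "y(b := 0)"]) (simp only: sum_upd, simp)
    qed
  next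
    case False
    then obtain p where p: "p \<in> X" "p b \<noteq> 0" by blast
    define X' where "X' = {h \<in> X. h b = 0}"
    define f' where "f' = (\<lambda>a. f a - f b / p b * p a)"
    have "\<exists>y. (\<forall>h\<in>X'. (\<Sum>a\<in>F. h a * y a) = 0) \<and> (\<Sum>a\<in>F. f' a * y a) \<noteq> 0"
    proof (rule insert.IH)
      obtain l where "l \<in> X" "\<forall>a\<in>insert b F. l a = p a + (-1) * p a"
        using lin[OF p(1) p(1)] by blast
      then have "l \<in> X'" unfolding X'_def by auto
      then show "X' \<noteq> {}" by blast
      show "\<exists>l\<in>X'. \<forall>a\<in>F. l a = h a + c * k a" if "h \<in> X'" "k \<in> X'" for h k c
        using lin[of h k c] that by (auto simp: X'_def)
      show "\<exists>a\<in>F. h a \<noteq> f' a" if h: "h \<in> X'" for h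
      proof -
        obtain l where l: "l \<in> X" "\<forall>a\<in>insert b F. l a = h a + (f b / p b) * p a"
          using lin[of h p] h p(1) unfolding X'_def by blast
        moreover have "l b = f b" using l(2) h p(2) by (simp add: X'_def)
        ultimately obtain a where "a \<in> F" "l a \<noteq> f a" using insert.prems(3)[OF l(1)] by auto
        then show ?thesis using l(2) by (intro bexI[of _ a]) (auto simp: f'_def)
      qed
    qed
    then obtain y where y: "\<And>h. h \<in> X' \<Longrightarrow> (\<Sum>a\<in>F. h a * y a) = 0" "(\<Sum>a\<in>F. f' a * y a) \<noteq> 0"
      by blast
    define v where "v = - (\<Sum>a\<in>F. p a * y a) / p b"
    have "h b * v + (\<Sum>a\<in>F. h a * y a) = 0" if h: "h \<in> X" for h
    proof -
      obtain l where l: "l \<in> X" "\<forall>a\<in>insert b F. l a = h a + (- (h b / p b)) * p a"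
        using lin[OF h p(1)] by blast
      then have "l \<in> X'" using p(2) by (auto simp: X'_def)
      then have "(\<Sum>a\<in>F. l a * y a) = 0" by (rule y(1))
      moreover have "(\<Sum>a\<in>F. l a * y a) = (\<Sum>a\<in>F. (h a + (- (h b / p b)) * p a) * y a)"
        using l(2) by (intro sum.cong) auto
      ultimately have "0 = (\<Sum>a\<in>F. (h a + (- (h b / p b)) * p a) * y a)" by simp
      then show ?thesis
        by (simp add: v_def sum_distrib_left sum_divide_distrib sum_subtractf algebra_simps)
    qed
    moreover have "f b * v + (\<Sum>a\<in>F. f a * y a) = (\<Sum>a\<in>F. f' a * y a)"
      by (simp add: f'_def v_def sum_distrib_left sum_divide_distrib sum_subtractf algebra_simps)
    ultimately show ?thesis
      using y(2) by (intro exI[of _ "y(b := v)"]) (simp only: sum_upd, simp)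
  qed
qed

text \<open>
  A basic neighbourhood of \<open>f\<close> in the product topology that misses \<open>X\<close> constrains finitely many
  coordinates only; a function agreeing with \<open>f\<close> there lies in the neighbourhood.
\<close>
lemma pointwise_closed_finite_witness:
  assumes closed: "pointwise_closed_in G V X"
    and V: "V \<subseteq> real_functions G" and f: "f \<in> V" "f \<notin> X"
  shows "\<exists>F. finite F \<and> F \<subseteq> carrier G \<and> (\<forall>h\<in>X. \<exists>a\<in>F. h a \<noteq> f a)"
proof -
  have top: "topspace (subtopology (powertop_real (carrier G)) V) = V"
    using V by (auto simp: real_functions_def)
  have XV: "X \<subseteq> V" and "openin (subtopology (powertop_real (carrier G)) V) (V - X)"
    using closed top unfolding pointwise_closed_in_def closedin_def by auto
  then obtain U where U: "openin (powertop_real (carrier G)) U" "V - X = U \<inter> V"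
    by (auto simp: openin_subtopology)
  then have "f \<in> U" using f by blast
  then obtain W where W: "finite {a \<in> carrier G. W a \<noteq> UNIV}" "f \<in> Pi\<^sub>E (carrier G) W"
      "Pi\<^sub>E (carrier G) W \<subseteq> U"
    using U(1) unfolding openin_product_topology_alt by fastforce
  show ?thesis
  proof (intro exI conjI ballI)
    show "finite {a \<in> carrier G. W a \<noteq> UNIV}" by (rule W(1))
    fix h assume h: "h \<in> X"
    show "\<exists>a\<in>{a \<in> carrier G. W a \<noteq> UNIV}. h a \<noteq> f a"
    proof (rule ccontr)
      assume "\<not> ?thesis"
      then have "h a \<in> W a" if "a \<in> carrier G" for a
        using that W(2) by (cases "W a = UNIV") (auto simp: PiE_iff)
      moreover have "h \<in> extensional (carrier G)"
        using h XV V by (auto simp: real_functions_def PiE_def)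
      ultimately have "h \<in> Pi\<^sub>E (carrier G) W" by (simp add: PiE_iff)
      then have "h \<in> U" using W(3) by blast
      then show False using h XV U(2) by blast
    qed
  qed auto
qed

context group
begin

text \<open>The case of a translation is the identity \<open>(f \<star> (x \<star> k)) (g) = (f \<star> x) (g inv k)\<close>.\<close>
lemma annihilator_submodule: "right_submodule G (carrier G) (annihilator G f)"
  unfolding right_submodule_def
proof (intro conjI ballI allI)
  show "annihilator G f \<subseteq> finite_support (carrier G)" by (auto simp: annihilator_def)
  show "(\<lambda>_. 0) \<in> annihilator G f" by (simp add: annihilator_def finite_support_zero)
next
  fix x y c assume "x \<in> annihilator G f" "y \<in> annihilator G f"
  then have xy: "x \<in> finite_support (carrier G)" "y \<in> finite_support (carrier G)"
    "\<forall>g\<in>carrier G. (\<Sum>h | x h \<noteq> 0. f (g \<otimes> inv h) * x h) = 0"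
    "\<forall>g\<in>carrier G. (\<Sum>h | y h \<noteq> 0. f (g \<otimes> inv h) * y h) = 0"
    by (auto simp: annihilator_def)
  then have "finite {h. x h \<noteq> 0}" "finite {h. y h \<noteq> 0}" by (auto simp: finite_support_def)
  note sum_support_linear[OF this]
  with xy show "(\<lambda>g. x g + c * y g) \<in> annihilator G f"
    by (simp add: annihilator_def finite_support_linear)
next
  fix x k assume x: "x \<in> annihilator G f" and k: "k \<in> carrier G"
  have fin: "x \<in> finite_support (carrier G)" using x by (simp add: annihilator_def)
  have rt: "right_translate G x k \<in> finite_support (carrier G)"
    using k by (intro right_translate_finite_support[OF fin]) auto
  have "(\<Sum>h | right_translate G x k h \<noteq> 0. f (g \<otimes> inv h) * right_translate G x k h) =
      (\<Sum>h | x h \<noteq> 0. f ((g \<otimes> inv k) \<otimes> inv h) * x h)" if g: "g \<in> carrier G" for g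
  proof (rule sum.reindex_bij_witness[where i = "\<lambda>h. h \<otimes> k" and j = "\<lambda>h. h \<otimes> inv k"])
    fix h assume h: "h \<in> {h. right_translate G x k h \<noteq> 0}"
    then have hc: "h \<in> carrier G" "x (h \<otimes> inv k) \<noteq> 0"
      by (auto simp: right_translate_def split: if_splits)
    show "h \<otimes> inv k \<otimes> k = h" using hc k by (simp add: m_assoc)
    show "h \<otimes> inv k \<in> {h. x h \<noteq> 0}" using hc by simp
    have "g \<otimes> inv k \<otimes> inv (h \<otimes> inv k) = g \<otimes> inv h"
      using g hc(1) k m_assoc[of "inv k" k "inv h"] by (simp add: inv_mult_group m_assoc)
    then show "f (g \<otimes> inv k \<otimes> inv (h \<otimes> inv k)) * x (h \<otimes> inv k) =
        f (g \<otimes> inv h) * right_translate G x k h"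
      using hc(1) by (simp add: right_translate_def)
  next
    fix h assume h: "h \<in> {h. x h \<noteq> 0}"
    then have hc: "h \<in> carrier G" using fin by (auto simp: finite_support_def)
    show "h \<otimes> k \<otimes> inv k = h" using hc k by (simp add: m_assoc)
    then show "h \<otimes> k \<in> {h. right_translate G x k h \<noteq> 0}"
      using h hc k by (simp add: right_translate_def)
  qed
  then show "right_translate G x k \<in> annihilator G f"
    using x rt k by (auto simp: annihilator_def)
qed

text \<open>
  The functional \<open>y\<close> separating \<open>f\<close> from \<open>X\<close> on a finite set of points is turned into an element of
  \<open>\<real>[G]\<close> as follows: \<open>y'\<close> is \<open>y\<close> with \<open>sum y F\<close> subtracted from its weight at the unit, so that
  its total weight is \<open>0\<close>, and \<open>x\<close> is \<open>y'\<close> composed with inversion, so that \<open>(w \<star> x) (g)\<close> pairs \<open>y'\<close>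
  with \<open>w (g \<cdot>)\<close>. Up to a constant \<open>w (g \<cdot>)\<close> is a translate of \<open>w\<close>, hence stays in \<open>X\<close> if \<open>w\<close> is
  in \<open>X\<close>.
\<close>
lemma annihilator_separates:
  assumes lin: "linear_subspace_of G V X" and inv: "translation_invariant G X"
    and closed: "pointwise_closed_in G V X"
    and V: "V \<subseteq> real_functions G" "\<And>f. f \<in> V \<Longrightarrow> f \<one> = 0"
    and f: "f \<in> V" "f \<notin> X"
  shows "\<exists>x \<in> \<Inter>(annihilator G ` plus_constants G X). \<forall>c. x \<notin> annihilator G (\<lambda>a\<in>carrier G. f a + c)"
proof -
  have XV: "X \<subseteq> V" and X0: "(\<lambda>x\<in>carrier G. 0) \<in> X"
    and X_add: "\<And>h k. h \<in> X \<Longrightarrow> k \<in> X \<Longrightarrow> (\<lambda>x\<in>carrier G. h x + k x) \<in> X"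
    and X_scale: "\<And>c h. h \<in> X \<Longrightarrow> (\<lambda>x\<in>carrier G. c * h x) \<in> X"
    using lin unfolding linear_subspace_of_def by auto
  obtain F where F: "finite F" "F \<subseteq> carrier G" "\<forall>h\<in>X. \<exists>a\<in>F. h a \<noteq> f a"
    using pointwise_closed_finite_witness[OF closed V(1) f] by blast
  have "\<exists>y. (\<forall>h\<in>X. (\<Sum>a\<in>F. h a * y a) = 0) \<and> (\<Sum>a\<in>F. f a * y a) \<noteq> 0"
  proof (rule finite_dimensional_separation[OF F(1)])
    show "\<exists>l\<in>X. \<forall>a\<in>F. l a = h a + c * k a" if "h \<in> X" "k \<in> X" for h k c
      using X_add[OF that(1) X_scale[OF that(2), of c]] F(2)
      by (intro bexI) auto
  qed (use X0 F(3) in auto)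
  then obtain y where y: "\<And>h. h \<in> X \<Longrightarrow> (\<Sum>a\<in>F. h a * y a) = 0" "(\<Sum>a\<in>F. f a * y a) \<noteq> 0"
    by blast
  define y' where "y' = (\<lambda>a. (if a \<in> F then y a else 0) - (if a = \<one> then sum y F else 0))"
  define A where "A = insert \<one> F"
  define x where "x = (\<lambda>h. if h \<in> carrier G then y' (inv h) else 0)"
  have A: "finite A" "A \<subseteq> carrier G" using F by (auto simp: A_def)
  have y'_sum: "(\<Sum>a\<in>A. w a * y' a) = (\<Sum>a\<in>F. w a * y a) - w \<one> * sum y F" for w
  proof -
    have "(\<Sum>a\<in>A. w a * (if a \<in> F then y a else 0)) = (\<Sum>a\<in>F. w a * y a)"
      using F(1) by (intro sum.mono_neutral_cong_right) (auto simp: A_def)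
    moreover have "(\<Sum>a\<in>A. w a * (if a = \<one> then sum y F else 0)) = w \<one> * sum y F"
      using A(1) by (simp add: A_def if_distrib[of "\<lambda>z. _ * z"] cong: if_cong)
    ultimately show ?thesis
      by (simp add: y'_def right_diff_distrib sum_subtractf)
  qed
  have supp: "{h. x h \<noteq> 0} \<subseteq> m_inv G ` A"
  proof
    fix h assume "h \<in> {h. x h \<noteq> 0}"
    then have "h \<in> carrier G" "inv h \<in> A"
      by (auto simp: x_def y'_def A_def split: if_splits)
    then show "h \<in> m_inv G ` A" by (intro image_eqI[of _ _ "inv h"]) auto
  qed
  have x_fin: "x \<in> finite_support (carrier G)"
    using finite_subset[OF supp] A by (auto simp: finite_support_def x_def split: if_splits)
  have conv: "(\<Sum>h | x h \<noteq> 0. w (g \<otimes> inv h) * x h) = (\<Sum>a\<in>A. w (g \<otimes> a) * y' a)"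
    for w :: "'a \<Rightarrow> real" and g
  proof -
    have "(\<Sum>h | x h \<noteq> 0. w (g \<otimes> inv h) * x h) = (\<Sum>h\<in>m_inv G ` A. w (g \<otimes> inv h) * x h)"
      using A(1) supp by (intro sum.mono_neutral_left) auto
    also have "\<dots> = (\<Sum>a\<in>A. w (g \<otimes> a) * y' a)"
      using A(2) inv_inj by (subst sum.reindex) (auto simp: x_def intro: inj_on_subset intro!: sum.cong)
    finally show ?thesis .
  qed
  have kills: "x \<in> annihilator G k" if k: "k \<in> plus_constants G X" for k
  proof -
    obtain h c where h: "h \<in> X" "k = (\<lambda>a\<in>carrier G. h a + c)"
      using k by (auto simp: plus_constants_def constants_def cong: restrict_cong)
    have "(\<Sum>a\<in>A. k (g \<otimes> a) * y' a) = 0" if g: "g \<in> carrier G" for g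
    proof -
      have "translate G (inv g) h \<in> X"
        using inv h(1) g unfolding translation_invariant_def by blast
      from y(1)[OF this] have 0: "(\<Sum>a\<in>F. (h (g \<otimes> a) - h g) * y a) = 0"
        using F(2) g by (simp add: translate_def subset_eq cong: sum.cong)
      have "(\<Sum>a\<in>A. k (g \<otimes> a) * y' a) = (\<Sum>a\<in>A. (h (g \<otimes> a) + c) * y' a)"
        using A(2) g h(2) by (intro sum.cong) auto
      also have "\<dots> = (\<Sum>a\<in>F. (h (g \<otimes> a) - h g) * y a)"
        unfolding y'_sum using g
        by (simp add: sum_distrib_left sum.distrib sum_subtractf algebra_simps)
      finally show ?thesis using 0 by simp
    qed
    then show ?thesis using x_fin by (simp add: annihilator_def conv)
  qed
  have "x \<notin> annihilator G (\<lambda>a\<in>carrier G. f a + c)" for c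
  proof
    assume "x \<in> annihilator G (\<lambda>a\<in>carrier G. f a + c)"
    then have "(\<Sum>a\<in>A. (\<lambda>a\<in>carrier G. f a + c) (\<one> \<otimes> a) * y' a) = 0"
      unfolding annihilator_def conv[symmetric] by blast
    moreover have "(\<Sum>a\<in>A. (\<lambda>a\<in>carrier G. f a + c) (\<one> \<otimes> a) * y' a) = (\<Sum>a\<in>A. (f a + c) * y' a)"
      using A(2) by (intro sum.cong) auto
    moreover have "(\<Sum>a\<in>A. (f a + c) * y' a) = (\<Sum>a\<in>F. f a * y a)"
      unfolding y'_sum using V(2)[OF f(1)]
      by (simp add: sum_distrib_left sum.distrib algebra_simps)
    ultimately show False using y(2) by simp
  qed
  with kills show ?thesis by blast
qed

end

text \<open>
  Finitely many generators of the right ideal \<open>I\<close> define the presentation: the annihilator of a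
  function \<open>f\<close> in their common kernel is a right ideal containing the generators, hence contains \<open>I\<close>,
  and by duality the normalisation of \<open>f\<close> at the unit lies in \<open>X\<close>.
\<close>
theorem proposition3p7:
  fixes G :: "('a, 'b) monoid_scheme" and S :: "'a set" and X :: "('a \<Rightarrow> real) set"
  assumes "group G"
    and "infinite (carrier G)"
    and "finite_symmetric_generating_set G S"
    and "polycyclic G"
    and "linear_subspace_of G (Lip0 G S) X"
    and "translation_invariant G X"
    and "pointwise_closed_in G (Lip0 G S) X"
  shows "finitely_presented G S X"
proof -
  interpret group G by (rule assms(1))
  define I where "I = \<Inter>(annihilator G ` plus_constants G X)"
  have X_sub: "X \<subseteq> Lip0 G S" and X0: "(\<lambda>x\<in>carrier G. 0) \<in> X"
    using assms(5) by (auto simp: linear_subspace_of_def)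
  have "plus_constants G X \<noteq> {}"
    using X0 by (auto simp: plus_constants_def constants_def)
  then have I_sub: "right_submodule G (carrier G) I"
    unfolding I_def using annihilator_submodule by (intro right_submodule_Inter) auto
  obtain F where F: "finite F" "F \<subseteq> I"
    "\<And>N. right_submodule G (carrier G) N \<Longrightarrow> F \<subseteq> N \<Longrightarrow> I \<subseteq> N"
    using right_noetherianE[OF polycyclic_right_noetherian[OF assms(4)] I_sub] by blast
  have F_fin: "F \<subseteq> finite_support (carrier G)"
    using F(2) right_submoduleD(1)[OF I_sub] by blast
  obtain e where "bij_betw e {1..card F} F"
    using ex_bij_betw_nat_finite_1[OF F(1)] by blast
  then have e: "e ` {1..card F} = F" by (simp add: bij_betw_def)
  define x where "x i = restrict (e i) (carrier G)" for i
  have pc_real: "f \<in> real_functions G" if "f \<in> plus_constants G Y" for f Y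
    using that by (auto simp: plus_constants_def real_functions_def)
  have kernels: "f \<in> (\<Inter>i\<in>{1..card F}. ker_P G (x i)) \<longleftrightarrow> F \<subseteq> annihilator G f"
    if "f \<in> real_functions G" for f
  proof -
    have "f \<in> ker_P G (x i) \<longleftrightarrow> e i \<in> annihilator G f" if "i \<in> {1..card F}" for i
      using that F_fin e \<open>f \<in> real_functions G\<close> ker_P_iff_annihilator[of "e i" G f]
      unfolding x_def by blast
    then have "f \<in> (\<Inter>i\<in>{1..card F}. ker_P G (x i)) \<longleftrightarrow> e ` {1..card F} \<subseteq> annihilator G f"
      by auto
    then show ?thesis unfolding e .
  qed
  show ?thesis
    unfolding finitely_presented_def
  proof (intro exI[of _ "card F"] exI[of _ x] conjI ballI)
    fix i assume "i \<in> {1..card F}"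
    then have "e i \<in> finite_support (carrier G)" using e F_fin by blast
    then show "x i \<in> real_group_algebra G"
      by (auto simp: x_def real_group_algebra_def real_functions_def finite_support_def
          elim: finite_subset[rotated])
  next
    show "plus_constants G X =
        plus_constants G (Lip0 G S) \<inter> (\<Inter>i\<in>{1..card F}. ker_P G (x i))"
    proof (intro equalityI subsetI)
      fix f assume f: "f \<in> plus_constants G X"
      then have "F \<subseteq> annihilator G f" using F(2) by (auto simp: I_def)
      moreover have "f \<in> plus_constants G (Lip0 G S)"
        using f X_sub by (auto simp: plus_constants_def)
      ultimately show "f \<in> plus_constants G (Lip0 G S) \<inter> (\<Inter>i\<in>{1..card F}. ker_P G (x i))"
        using kernels[OF pc_real[OF f]] by blast
    next
      fix f assume f: "f \<in> plus_constants G (Lip0 G S) \<inter> (\<Inter>i\<in>{1..card F}. ker_P G (x i))"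
      then have "F \<subseteq> annihilator G f" using kernels pc_real by blast
      then have I: "I \<subseteq> annihilator G f" by (rule F(3)[OF annihilator_submodule])
      obtain f0 c where f0: "f0 \<in> Lip0 G S" "f = (\<lambda>a\<in>carrier G. f0 a + c)"
        using f by (auto simp: plus_constants_def constants_def cong: restrict_cong)
      have "f0 \<in> X"
      proof (rule ccontr)
        assume "f0 \<notin> X"
        have Lip0_real: "Lip0 G S \<subseteq> real_functions G" and Lip0_one: "\<And>h. h \<in> Lip0 G S \<Longrightarrow> h \<one>\<^bsub>G\<^esub> = 0"
          by (auto simp: Lip0_def)
        have "\<exists>z\<in>I. \<forall>c. z \<notin> annihilator G (\<lambda>a\<in>carrier G. f0 a + c)"
          unfolding I_def
          by (rule annihilator_separates[OF assms(5-7) Lip0_real _ f0(1) \<open>f0 \<notin> X\<close>]) (rule Lip0_one)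
        then show False using I f0(2) by blast
      qed
      then show "f \<in> plus_constants G X"
        unfolding plus_constants_def constants_def mem_Collect_eq
        by (intro exI[of _ f0] exI[of _ "\<lambda>x\<in>carrier G. c"])
          (auto simp: f0(2) cong: restrict_cong)
    qed
  qed
qed

end
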